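(* Let $A$ be an associative algebra and let $(r_1,r_2)$ be a pair of skew-symmetric elements of $A\otimes A$, $r_1=\sum r_1^{[1]}\otimes r_1^{[2]}$ and $r_2=\sum r_2^{[1]}\otimes r_2^{[2]}$. Define $r_1^\sharp,r_2^\sharp:A^*\to A$ by $$r_1^\sharp(f)=\sum f(r_1^{[2]})\,r_1^{[1]},\qquad r_2^\sharp(f)=\sum f(r_2^{[2]})\,r_2^{[1]},\qquad f\in A^*.$$ Then $(r_1,r_2)$ is a compatible associative Yang-Baxter solution on $A$ if and only if $(r_1^\sharp,r_2^\sharp)$ is a compatible $\mathcal{O}$-operator on the coadjoint bimodule $A^*$ over the algebra $A$.
   Context: All vector spaces are over a field $\mathbf{k}$ of characteristic $0$. For an associative algebra $A$ and an $A$-bimodule $M$ (with product and both actions denoted $\cdot$), an $\mathcal{O}$-operator on $M$ over $A$ is a linear map $T:M\to A$ with $T(u)\cdot T(v)=T(T(u)\cdot v+u\cdot T(v))$ for all $u,v\in M$. A compatible $\mathcal{O}$-operator on $M$ over $A$ is a pair $(T_1,T_2)$ of $\mathcal{O}$-operators such that for all $u,v\in M$ $$T_1(u)\cdot T_2(v)+T_2(u)\cdot T_1(v)=T_1(T_2(u)\cdot v+u\cdot T_2(v))+T_2(T_1(u)\cdot v+u\cdot T_1(v)).$$ The coadjoint bimodule is $A^*=\mathrm{Hom}(A,\mathbf{k})$ with $(a\cdot f)(b)=f(b\cdot a)$ and $(f\cdot a)(b)=f(a\cdot b)$ for $a,b\in A$, $f\in A^*$. An element $r=\sum r^{[1]}\otimes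 r^{[2]}\in A\otimes A$ is skew-symmetric if $\sum r^{[2]}\otimes r^{[1]}=-r$. An associative Yang-Baxter solution on $A$ is an element $r=\sum r^{[1]}\otimes r^{[2]}\in A\otimes A$ satisfying (with $\widetilde r$ a second copy of $r$) $$\sum r^{[1]}\cdot\widetilde r^{[1]}\otimes\widetilde r^{[2]}\otimes r^{[2]}-\sum r^{[1]}\otimes r^{[2]}\cdot\widetilde r^{[1]}\otimes\widetilde r^{[2]}+\sum\widetilde r^{[1]}\otimes r^{[1]}\otimes r^{[2]}\cdot\widetilde r^{[2]}=0 .$$ A compatible associative Yang-Baxter solution on $A$ is a pair $(r_1,r_2)$ of associative Yang-Baxter solutions satisfying $$\sum r_1^{[1]}\cdot r_2^{[1]}\otimes r_2^{[2]}\otimes r_1^{[2]}+\sum r_2^{[1]}\cdot r_1^{[1]}\otimes r_1^{[2]}\otimes r_2^{[2]}-\sum r_1^{[1]}\otimes r_1^{[2]}\cdot r_2^{[1]}\otimes r_2^{[2]}-\sum r_2^{[1]}\otimes r_2^{[2]}\cdot r_1^{[1]}\otimes r_1^{[2]}$$ $$+\sum r_2^{[1]}\otimes r_1^{[1]}\otimes r_1^{[2]}\cdot r_2^{[2]}+\sum r_1^{[1]}\otimes r_2^{[1]}\otimes r_2^{[2]}\cdot r_1^{[2]}=0.$$ *)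

theory Defs
  imports Complex_Main "HOL-Library.Poly_Mapping" "HOL-Library.Function_Algebras"
begin

section \<open>Free vector spaces\<close>

text \<open>The free vector space on a type of generators is the type of finitely supported functions;
  \<open>free_ext s \<beta>\<close> is the linear map into the space with scalar multiplication \<open>s\<close> that extends the
  function \<open>\<beta>\<close> on generators.\<close>

definition free_scale :: "'k::field \<Rightarrow> ('x \<Rightarrow>\<^sub>0 'k) \<Rightarrow> ('x \<Rightarrow>\<^sub>0 'k)" where
  "free_scale c p = Poly_Mapping.map ((*) c) p"

definition gen :: "'x \<Rightarrow> ('x \<Rightarrow>\<^sub>0 'k::field)" where
  "gen x = Poly_Mapping.single x 1"

definition free_ext ::
  "('k::field \<Rightarrow> 'v \<Rightarrow> 'v::ab_group_add) \<Rightarrow> ('x \<Rightarrow> 'v) \<Rightarrow> ('x \<Rightarrow>\<^sub>0 'k) \<Rightarrow> 'v" where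
  "free_ext s \<beta> p = (\<Sum>x\<in>Poly_Mapping.keys p. s (Poly_Mapping.lookup p x) (\<beta> x))"

lemma lookup_free_scale [simp]:
  "Poly_Mapping.lookup (free_scale c p) x = c * Poly_Mapping.lookup p x"
  by (simp add: free_scale_def Poly_Mapping.map.rep_eq when_def)

global_interpretation free: vector_space "free_scale :: 'k::field \<Rightarrow> ('x \<Rightarrow>\<^sub>0 'k) \<Rightarrow> ('x \<Rightarrow>\<^sub>0 'k)"
  by unfold_locales (auto intro!: poly_mapping_eqI simp: lookup_add algebra_simps)

lemma free_ext_superset:
  assumes "vector_space s" "finite S" "Poly_Mapping.keys p \<subseteq> S"
  shows "free_ext s \<beta> p = (\<Sum>x\<in>S. s (Poly_Mapping.lookup p x) (\<beta> x))"
proof -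
  interpret vector_space s by fact
  show ?thesis unfolding free_ext_def
    by (rule sum.mono_neutral_left) (use assms in \<open>auto simp: in_keys_iff\<close>)
qed

lemma linear_free_ext:
  fixes s :: "'k::field \<Rightarrow> 'v::ab_group_add \<Rightarrow> 'v" and \<beta> :: "'x \<Rightarrow> 'v"
  assumes "vector_space s"
  shows "Vector_Spaces.linear free_scale s (free_ext s \<beta>)"
proof -
  interpret V: vector_space s by fact
  show ?thesis
    unfolding linear_iff_module_hom module_hom_iff
  proof (intro conjI allI free.module_axioms V.module_axioms)
    fix p q :: "'x \<Rightarrow>\<^sub>0 'k"
    let ?S = "Poly_Mapping.keys p \<union> Poly_Mapping.keys q"
    show "free_ext s \<beta> (p + q) = free_ext s \<beta> p + free_ext s \<beta> q"
      by (subst (1 2 3) free_ext_superset[OF assms, where S = ?S])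
         (auto simp: Poly_Mapping.keys_add lookup_add V.scale_left_distrib sum.distrib)
  next
    fix c and p :: "'x \<Rightarrow>\<^sub>0 'k"
    let ?S = "Poly_Mapping.keys p"
    have "Poly_Mapping.keys (free_scale c p) \<subseteq> ?S"
      by (auto simp: in_keys_iff)
    then show "free_ext s \<beta> (free_scale c p) = s c (free_ext s \<beta> p)"
      by (subst (1 2) free_ext_superset[OF assms, where S = ?S])
         (auto simp: V.scale_sum_right)
  qed
qed

lemma free_ext_gen [simp]:
  assumes "vector_space s"
  shows "free_ext s \<beta> (gen x) = \<beta> x"
proof -
  interpret vector_space s by fact
  show ?thesis by (simp add: free_ext_def gen_def)
qed


section \<open>Cosets\<close>

definition coset :: "'v::ab_group_add set \<Rightarrow> 'v \<Rightarrow> 'v set" where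
  "coset N p = {q. q - p \<in> N}"

lemma UN_constant_on: "x \<in> X \<Longrightarrow> (\<And>y. y \<in> X \<Longrightarrow> F y = F x) \<Longrightarrow> (\<Union>y\<in>X. F y) = F x"
  by blast

text \<open>On cosets of one subspace these elementwise operations are the operations of the quotient
  space, in which the zero element is the subspace itself.\<close>

definition coset_add :: "'v::ab_group_add set \<Rightarrow> 'v set \<Rightarrow> 'v set" (infixl "\<boxplus>" 65) where
  "X \<boxplus> Y = {p + q | p q. p \<in> X \<and> q \<in> Y}"

definition coset_diff :: "'v::ab_group_add set \<Rightarrow> 'v set \<Rightarrow> 'v set" (infixl "\<boxminus>" 65) where
  "X \<boxminus> Y = {p - q | p q. p \<in> X \<and> q \<in> Y}"

definition coset_neg :: "'v::ab_group_add set \<Rightarrow> 'v set" where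
  "coset_neg X = {- p | p. p \<in> X}"

context vector_space
begin

lemma coset_eq_iff:
  assumes "subspace N"
  shows "coset N p = coset N q \<longleftrightarrow> p - q \<in> N"
proof
  assume "coset N p = coset N q"
  moreover have "p \<in> coset N p" using assms by (simp add: coset_def subspace_0)
  ultimately show "p - q \<in> N" by (simp add: coset_def)
next
  assume *: "p - q \<in> N"
  have "x - p \<in> N \<longleftrightarrow> x - q \<in> N" for x
    using subspace_add[OF assms _ *, of "x - p"] subspace_diff[OF assms _ *, of "x - q"]
    by auto
  then show "coset N p = coset N q" by (auto simp: coset_def)
qed

lemma coset_0: "coset N 0 = N"
  by (simp add: coset_def)

lemma coset_add_coset:
  assumes "subspace N"
  shows "coset N p \<boxplus> coset N q = coset N (p + q)"
proof (intro set_eqI iffI)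
  fix x assume "x \<in> coset N p \<boxplus> coset N q"
  then obtain u v where "x = u + v" "u - p \<in> N" "v - q \<in> N"
    by (auto simp: coset_add_def coset_def)
  then show "x \<in> coset N (p + q)"
    using subspace_add[OF assms, of "u - p" "v - q"] by (simp add: coset_def algebra_simps)
next
  fix x assume "x \<in> coset N (p + q)"
  then have "x - q \<in> coset N p" "q \<in> coset N q" "x = (x - q) + q"
    using assms by (auto simp: coset_def subspace_0 algebra_simps)
  then show "x \<in> coset N p \<boxplus> coset N q" unfolding coset_add_def by blast
qed

lemma coset_neg_coset:
  assumes "subspace N"
  shows "coset_neg (coset N p) = coset N (- p)"
proof (intro set_eqI iffI)
  fix x assume "x \<in> coset_neg (coset N p)"
  then obtain u where "x = - u" "u - p \<in> N" by (auto simp: coset_neg_def coset_def)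
  then show "x \<in> coset N (- p)"
    using subspace_neg[OF assms, of "u - p"] by (simp add: coset_def)
next
  fix x assume "x \<in> coset N (- p)"
  then have "- x \<in> coset N p" "x = - (- x)"
    using subspace_neg[OF assms, of "x + p"] by (auto simp: coset_def)
  then show "x \<in> coset_neg (coset N p)" unfolding coset_neg_def by blast
qed

lemma coset_diff_coset:
  assumes "subspace N"
  shows "coset N p \<boxminus> coset N q = coset N (p - q)"
proof -
  have "coset N p \<boxminus> coset N q = coset N p \<boxplus> coset_neg (coset N q)"
    unfolding coset_diff_def coset_add_def coset_neg_def by force
  then show ?thesis
    by (simp add: coset_neg_coset coset_add_coset assms)
qed

end


section \<open>Algebras, bimodules and O-operators\<close>

text \<open>Associativity and distributivity of the product are part of the class \<^class>\<open>ring\<close>, which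
  does not require a unit.\<close>

locale assoc_algebra = vector_space scale
  for scale :: "'k::field_char_0 \<Rightarrow> 'a::ring \<Rightarrow> 'a" +
  assumes mult_scale_left: "scale c a * b = scale c (a * b)"
    and mult_scale_right: "a * scale c b = scale c (a * b)"

locale bimodule = assoc_algebra scale + M: vector_space scaleM
  for scale :: "'k::field_char_0 \<Rightarrow> 'a::ring \<Rightarrow> 'a"
    and scaleM :: "'k \<Rightarrow> 'm::ab_group_add \<Rightarrow> 'm" +
  fixes M :: "'m set"
    and lact :: "'a \<Rightarrow> 'm \<Rightarrow> 'm"
    and ract :: "'m \<Rightarrow> 'a \<Rightarrow> 'm"
  assumes subspace_M: "M.subspace M"
    and lact_closed: "u \<in> M \<Longrightarrow> lact a u \<in> M"
    and ract_closed: "u \<in> M \<Longrightarrow> ract u a \<in> M"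
    and lact_add_left: "u \<in> M \<Longrightarrow> lact (a + b) u = lact a u + lact b u"
    and lact_add_right: "u \<in> M \<Longrightarrow> v \<in> M \<Longrightarrow> lact a (u + v) = lact a u + lact a v"
    and lact_scale_left: "u \<in> M \<Longrightarrow> lact (scale c a) u = scaleM c (lact a u)"
    and lact_scale_right: "u \<in> M \<Longrightarrow> lact a (scaleM c u) = scaleM c (lact a u)"
    and ract_add_left: "u \<in> M \<Longrightarrow> v \<in> M \<Longrightarrow> ract (u + v) a = ract u a + ract v a"
    and ract_add_right: "u \<in> M \<Longrightarrow> ract u (a + b) = ract u a + ract u b"
    and ract_scale_left: "u \<in> M \<Longrightarrow> ract (scaleM c u) a = scaleM c (ract u a)"
    and ract_scale_right: "u \<in> M \<Longrightarrow> ract u (scale c a) = scaleM c (ract u a)"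
    and lact_mult: "u \<in> M \<Longrightarrow> lact (a * b) u = lact a (lact b u)"
    and ract_mult: "u \<in> M \<Longrightarrow> ract u (a * b) = ract (ract u a) b"
    and lact_ract: "u \<in> M \<Longrightarrow> ract (lact a u) b = lact a (ract u b)"
begin

text \<open>Only the values of \<open>T\<close> on the carrier \<open>M\<close> matter.\<close>

definition O_operator :: "('m \<Rightarrow> 'a) \<Rightarrow> bool" where
  "O_operator T \<longleftrightarrow>
     (\<forall>u\<in>M. \<forall>v\<in>M. T (u + v) = T u + T v) \<and>
     (\<forall>c. \<forall>u\<in>M. T (scaleM c u) = scale c (T u)) \<and>
     (\<forall>u\<in>M. \<forall>v\<in>M. T u * T v = T (lact (T u) v + ract u (T v)))"

definition compatible_O_operator :: "('m \<Rightarrow> 'a) \<Rightarrow> ('m \<Rightarrow> 'a) \<Rightarrow> bool" where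
  "compatible_O_operator T1 T2 \<longleftrightarrow> O_operator T1 \<and> O_operator T2 \<and>
     (\<forall>u\<in>M. \<forall>v\<in>M. T1 u * T2 v + T2 u * T1 v =
        T1 (lact (T2 u) v + ract u (T2 v)) + T2 (lact (T1 u) v + ract u (T1 v)))"

end


section \<open>The coadjoint bimodule\<close>

definition dual_scale :: "'k::field \<Rightarrow> ('a \<Rightarrow> 'k) \<Rightarrow> ('a \<Rightarrow> 'k)" where
  "dual_scale c f = (\<lambda>b. c * f b)"

definition dual_space :: "('k::field \<Rightarrow> 'a::ab_group_add \<Rightarrow> 'a) \<Rightarrow> ('a \<Rightarrow> 'k) set" where
  "dual_space scale = {f. Vector_Spaces.linear scale (*) f}"

definition coad_left :: "'a::ring \<Rightarrow> ('a \<Rightarrow> 'k) \<Rightarrow> ('a \<Rightarrow> 'k)" where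
  "coad_left a f = (\<lambda>b. f (b * a))"

definition coad_right :: "('a::ring \<Rightarrow> 'k) \<Rightarrow> 'a \<Rightarrow> ('a \<Rightarrow> 'k)" where
  "coad_right f a = (\<lambda>b. f (a * b))"

lemma vector_space_field: "vector_space ((*) :: 'k::field \<Rightarrow> 'k \<Rightarrow> 'k)"
  by unfold_locales (auto simp: algebra_simps)

lemma vector_space_dual_scale: "vector_space (dual_scale :: 'k::field \<Rightarrow> ('a \<Rightarrow> 'k) \<Rightarrow> _)"
  by unfold_locales (auto simp: dual_scale_def algebra_simps)

context assoc_algebra
begin

lemma dual_space_iff:
  "f \<in> dual_space scale \<longleftrightarrow> (\<forall>a b. f (a + b) = f a + f b) \<and> (\<forall>c a. f (scale c a) = c * f a)"
proof -
  interpret F: vector_space "(*) :: 'k \<Rightarrow> 'k \<Rightarrow> 'k" by (rule vector_space_field)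
  show ?thesis
    by (simp add: dual_space_def linear_iff_module_hom module_hom_iff module_axioms F.module_axioms)
qed

sublocale coadjoint: bimodule scale dual_scale "dual_space scale" coad_left coad_right
proof -
  interpret D: vector_space "dual_scale :: 'k \<Rightarrow> ('a \<Rightarrow> 'k) \<Rightarrow> _"
    by (rule vector_space_dual_scale)
  show "bimodule scale dual_scale (dual_space scale) coad_left coad_right"
    by unfold_locales
       (auto simp: D.subspace_def dual_space_iff dual_scale_def coad_left_def coad_right_def
          algebra_simps mult_scale_left mult_scale_right)
qed

end


section \<open>Tensor products\<close>

text \<open>The spaces \<open>A \<otimes> A\<close> and \<open>A \<otimes> A \<otimes> A\<close> are the quotients of the free vector spaces on pairs and
  triples by the span of the multilinearity relations, so a tensor is a coset of formal sums.
  Functions of tensors are given on formal sums and lifted to cosets as in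
  \<^theory>\<open>HOL.Equiv_Relations\<close>.\<close>

context assoc_algebra
begin

definition null2 :: "(('a \<times> 'a) \<Rightarrow>\<^sub>0 'k) set" where
  "null2 = free.span
     ({gen (a + a', b) - (gen (a, b) + gen (a', b)) | a a' b. True} \<union>
      {gen (a, b + b') - (gen (a, b) + gen (a, b')) | a b b'. True} \<union>
      {gen (scale t a, b) - free_scale t (gen (a, b)) | t a b. True} \<union>
      {gen (a, scale t b) - free_scale t (gen (a, b)) | t a b. True})"

definition null3 :: "(('a \<times> 'a \<times> 'a) \<Rightarrow>\<^sub>0 'k) set" where
  "null3 = free.span
     ({gen (a + a', b, c) - (gen (a, b, c) + gen (a', b, c)) | a a' b c. True} \<union>
      {gen (a, b + b', c) - (gen (a, b, c) + gen (a, b', c)) | a b b' c. True} \<union>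
      {gen (a, b, c + c') - (gen (a, b, c) + gen (a, b, c')) | a b c c'. True} \<union>
      {gen (scale t a, b, c) - free_scale t (gen (a, b, c)) | t a b c. True} \<union>
      {gen (a, scale t b, c) - free_scale t (gen (a, b, c)) | t a b c. True} \<union>
      {gen (a, b, scale t c) - free_scale t (gen (a, b, c)) | t a b c. True})"

definition tensor2 :: "(('a \<times> 'a) \<Rightarrow>\<^sub>0 'k) set set" where
  "tensor2 = range (coset null2)"

definition flip :: "(('a \<times> 'a) \<Rightarrow>\<^sub>0 'k) set \<Rightarrow> (('a \<times> 'a) \<Rightarrow>\<^sub>0 'k) set" where
  "flip r = (\<Union>p\<in>r. coset null2 (free_ext free_scale (\<lambda>(a, b). gen (b, a)) p))"

definition skew_symmetric :: "(('a \<times> 'a) \<Rightarrow>\<^sub>0 'k) set \<Rightarrow> bool" where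
  "skew_symmetric r \<longleftrightarrow> flip r = coset_neg r"

definition sharp :: "(('a \<times> 'a) \<Rightarrow>\<^sub>0 'k) set \<Rightarrow> ('a \<Rightarrow> 'k) \<Rightarrow> 'a" where
  "sharp r f = the_elem (\<Union>p\<in>r. {free_ext scale (\<lambda>(a, b). scale (f b) a) p})"

text \<open>Writing \<open>r = \<Sum> a \<otimes> b\<close> and \<open>s = \<Sum> c \<otimes> d\<close>, the following are the elements
  \<open>\<Sum> a c \<otimes> d \<otimes> b\<close>, \<open>\<Sum> a \<otimes> b c \<otimes> d\<close> and \<open>\<Sum> c \<otimes> a \<otimes> b d\<close> of \<open>A \<otimes> A \<otimes> A\<close>.\<close>

definition yb_prod :: "('a \<Rightarrow> 'a \<Rightarrow> 'a \<Rightarrow> 'a \<Rightarrow> 'a \<times> 'a \<times> 'a) \<Rightarrow>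
    (('a \<times> 'a) \<Rightarrow>\<^sub>0 'k) set \<Rightarrow> (('a \<times> 'a) \<Rightarrow>\<^sub>0 'k) set \<Rightarrow> (('a \<times> 'a \<times> 'a) \<Rightarrow>\<^sub>0 'k) set" where
  "yb_prod \<mu> r s = (\<Union>p\<in>r. \<Union>q\<in>s. coset null3
     (free_ext free_scale (\<lambda>(a, b). free_ext free_scale (\<lambda>(c, d). gen (\<mu> a b c d)) q) p))"

definition yb_left where "yb_left = yb_prod (\<lambda>a b c d. (a * c, d, b))"
definition yb_middle where "yb_middle = yb_prod (\<lambda>a b c d. (a, b * c, d))"
definition yb_right where "yb_right = yb_prod (\<lambda>a b c d. (c, a, b * d))"

definition AYB_solution :: "(('a \<times> 'a) \<Rightarrow>\<^sub>0 'k) set \<Rightarrow> bool" where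
  "AYB_solution r \<longleftrightarrow> r \<in> tensor2 \<and>
     yb_left r r \<boxminus> yb_middle r r \<boxplus> yb_right r r = null3"

definition compatible_AYB_solution ::
  "(('a \<times> 'a) \<Rightarrow>\<^sub>0 'k) set \<Rightarrow> (('a \<times> 'a) \<Rightarrow>\<^sub>0 'k) set \<Rightarrow> bool" where
  "compatible_AYB_solution r1 r2 \<longleftrightarrow> AYB_solution r1 \<and> AYB_solution r2 \<and>
     yb_left r1 r2 \<boxplus> yb_left r2 r1 \<boxminus> yb_middle r1 r2 \<boxminus> yb_middle r2 r1
       \<boxplus> yb_right r1 r2 \<boxplus> yb_right r2 r1 = null3"

subsection \<open>The lifted functions are well defined\<close>

lemma subspace_null2: "free.subspace null2"
  unfolding null2_def by (rule free.subspace_span)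

lemma subspace_null3: "free.subspace null3"
  unfolding null3_def by (rule free.subspace_span)

lemma null2_rels:
  "gen (a + a', b) - (gen (a, b) + gen (a', b)) \<in> null2"
  "gen (a, b + b') - (gen (a, b) + gen (a, b')) \<in> null2"
  "gen (scale t a, b) - free_scale t (gen (a, b)) \<in> null2"
  "gen (a, scale t b) - free_scale t (gen (a, b)) \<in> null2"
  unfolding null2_def
  subgoal by (rule free.span_base, rule UnI1, rule UnI1, rule UnI1, rule CollectI, intro exI conjI TrueI, rule refl)
  subgoal by (rule free.span_base, rule UnI1, rule UnI1, rule UnI2, rule CollectI, intro exI conjI TrueI, rule refl)
  subgoal by (rule free.span_base, rule UnI1, rule UnI2, rule CollectI, intro exI conjI TrueI, rule refl)
  subgoal by (rule free.span_base, rule UnI2, rule CollectI, intro exI conjI TrueI, rule refl)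
  done

lemma null3_rels:
  "gen (a + a', b, c) - (gen (a, b, c) + gen (a', b, c)) \<in> null3"
  "gen (a, b + b', c) - (gen (a, b, c) + gen (a, b', c)) \<in> null3"
  "gen (a, b, c + c') - (gen (a, b, c) + gen (a, b, c')) \<in> null3"
  "gen (scale t a, b, c) - free_scale t (gen (a, b, c)) \<in> null3"
  "gen (a, scale t b, c) - free_scale t (gen (a, b, c)) \<in> null3"
  "gen (a, b, scale t c) - free_scale t (gen (a, b, c)) \<in> null3"
  unfolding null3_def
  subgoal by (rule free.span_base, rule UnI1, rule UnI1, rule UnI1, rule UnI1, rule UnI1, rule CollectI, intro exI conjI TrueI, rule refl)
  subgoal by (rule free.span_base, rule UnI1, rule UnI1, rule UnI1, rule UnI1, rule UnI2, rule CollectI, intro exI conjI TrueI, rule refl)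
  subgoal by (rule free.span_base, rule UnI1, rule UnI1, rule UnI1, rule UnI2, rule CollectI, intro exI conjI TrueI, rule refl)
  subgoal by (rule free.span_base, rule UnI1, rule UnI1, rule UnI2, rule CollectI, intro exI conjI TrueI, rule refl)
  subgoal by (rule free.span_base, rule UnI1, rule UnI2, rule CollectI, intro exI conjI TrueI, rule refl)
  subgoal by (rule free.span_base, rule UnI2, rule CollectI, intro exI conjI TrueI, rule refl)
  done

text \<open>A linear map on formal sums that is bilinear on generators modulo a subspace \<open>N\<close> descends to
  \<open>A \<otimes> A\<close>.\<close>

lemma null2_descends:
  assumes s: "vector_space s" and N: "module.subspace s N"
    and "\<And>a a' b. \<beta> (a + a', b) - (\<beta> (a, b) + \<beta> (a', b)) \<in> N"
    and "\<And>a b b'. \<beta> (a, b + b') - (\<beta> (a, b) + \<beta> (a, b')) \<in> N"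
    and "\<And>t a b. \<beta> (scale t a, b) - s t (\<beta> (a, b)) \<in> N"
    and "\<And>t a b. \<beta> (a, scale t b) - s t (\<beta> (a, b)) \<in> N"
    and p: "p \<in> null2"
  shows "free_ext s \<beta> p \<in> N"
proof -
  interpret V: vector_space s by fact
  interpret vector_space_pair free_scale s ..
  interpret L: Vector_Spaces.linear free_scale s "free_ext s \<beta>"
    by (rule linear_free_ext) fact
  let ?P = "{p. free_ext s \<beta> p \<in> N}"
  have "free.subspace ?P"
    using L.subspace_vimage[OF N] by (simp add: vimage_def)
  moreover have "free_ext s \<beta> (gen x) = \<beta> x" for x
    by (rule free_ext_gen) fact
  ultimately have "null2 \<subseteq> ?P"
    unfolding null2_def
    by (intro free.span_minimal) (use assms(3-6) in \<open>auto simp: L.diff L.add L.scale\<close>)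
  with p show ?thesis by blast
qed

lemma free_ext_cong_null2:
  assumes s: "vector_space s" and N: "module.subspace s N"
    and "\<And>a a' b. \<beta> (a + a', b) - (\<beta> (a, b) + \<beta> (a', b)) \<in> N"
    and "\<And>a b b'. \<beta> (a, b + b') - (\<beta> (a, b) + \<beta> (a, b')) \<in> N"
    and "\<And>t a b. \<beta> (scale t a, b) - s t (\<beta> (a, b)) \<in> N"
    and "\<And>t a b. \<beta> (a, scale t b) - s t (\<beta> (a, b)) \<in> N"
    and p: "p \<in> coset null2 q"
  shows "free_ext s \<beta> p - free_ext s \<beta> q \<in> N"
proof -
  interpret V: vector_space s by fact
  interpret L: Vector_Spaces.linear free_scale s "free_ext s \<beta>"
    by (rule linear_free_ext) fact
  show ?thesis
    using null2_descends[OF assms(1-6), of "p - q"] p by (simp add: coset_def L.diff)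
qed

lemma self_in_coset_null2: "p \<in> coset null2 p"
  using free.subspace_0[OF subspace_null2] by (simp add: coset_def)

lemma flip_coset:
  "flip (coset null2 p) = coset null2 (free_ext free_scale (\<lambda>(a, b). gen (b, a)) p)"
proof -
  have "free_ext free_scale (\<lambda>(a, b). gen (b, a)) q -
      free_ext free_scale (\<lambda>(a, b). gen (b, a)) p \<in> null2" if "q \<in> coset null2 p" for q
    by (rule free_ext_cong_null2[OF free.vector_space_axioms subspace_null2 _ _ _ _ that])
       (simp_all add: null2_rels)
  then show ?thesis
    unfolding flip_def
    by (intro UN_constant_on self_in_coset_null2) (simp only: free.coset_eq_iff[OF subspace_null2])
qed

lemma sharp_coset:
  assumes "f \<in> dual_space scale"
  shows "sharp (coset null2 p) f = free_ext scale (\<lambda>(a, b). scale (f b) a) p"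
proof -
  have "free_ext scale (\<lambda>(a, b). scale (f b) a) q -
      free_ext scale (\<lambda>(a, b). scale (f b) a) p \<in> {0}" if "q \<in> coset null2 p" for q
    by (rule free_ext_cong_null2[OF vector_space_axioms subspace_single_0 _ _ _ _ that])
       (use assms in \<open>auto simp: dual_space_iff algebra_simps\<close>)
  then have "(\<Union>q\<in>coset null2 p. {free_ext scale (\<lambda>(a, b). scale (f b) a) q}) =
      {free_ext scale (\<lambda>(a, b). scale (f b) a) p}"
    by (intro UN_constant_on self_in_coset_null2) simp
  then show ?thesis by (simp add: sharp_def)
qed

lemma yb_prod_coset:
  fixes \<mu> :: "'a \<Rightarrow> 'a \<Rightarrow> 'a \<Rightarrow> 'a \<Rightarrow> 'a \<times> 'a \<times> 'a"
  defines "F \<equiv> \<lambda>p q :: ('a \<times> 'a) \<Rightarrow>\<^sub>0 'k.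
     free_ext free_scale (\<lambda>(a, b). free_ext free_scale (\<lambda>(c, d). gen (\<mu> a b c d)) q) p"
  assumes \<mu>: "\<mu> \<in> {\<lambda>a b c d. (a * c, d, b), \<lambda>a b c d. (a, b * c, d), \<lambda>a b c d. (c, a, b * d)}"
  shows "yb_prod \<mu> (coset null2 p) (coset null2 q) = coset null3 (F p q)"
proof -
  let ?G = "\<lambda>x q. free_ext free_scale (\<lambda>(c, d). gen (\<mu> (fst x) (snd x) c d)) q"
  have gen_rel:
      "gen (\<mu> (a + a') b c d) - (gen (\<mu> a b c d) + gen (\<mu> a' b c d)) \<in> null3"
      "gen (\<mu> a (b + b') c d) - (gen (\<mu> a b c d) + gen (\<mu> a b' c d)) \<in> null3"
      "gen (\<mu> a b (c + c') d) - (gen (\<mu> a b c d) + gen (\<mu> a b c' d)) \<in> null3"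
      "gen (\<mu> a b c (d + d')) - (gen (\<mu> a b c d) + gen (\<mu> a b c d')) \<in> null3"
      "gen (\<mu> (scale t a) b c d) - free_scale t (gen (\<mu> a b c d)) \<in> null3"
      "gen (\<mu> a (scale t b) c d) - free_scale t (gen (\<mu> a b c d)) \<in> null3"
      "gen (\<mu> a b (scale t c) d) - free_scale t (gen (\<mu> a b c d)) \<in> null3"
      "gen (\<mu> a b c (scale t d)) - free_scale t (gen (\<mu> a b c d)) \<in> null3"
    for a a' b b' c c' d d' t
    subgoal using \<mu> by (elim insertE emptyE)
      (simp_all add: distrib_left distrib_right mult_scale_left mult_scale_right null3_rels)
    subgoal using \<mu> by (elim insertE emptyE)
      (simp_all add: distrib_left distrib_right mult_scale_left mult_scale_right null3_rels)
    subgoal using \<mu> by (elim insertE emptyE)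
      (simp_all add: distrib_left distrib_right mult_scale_left mult_scale_right null3_rels)
    subgoal using \<mu> by (elim insertE emptyE)
      (simp_all add: distrib_left distrib_right mult_scale_left mult_scale_right null3_rels)
    subgoal using \<mu> by (elim insertE emptyE)
      (simp_all add: distrib_left distrib_right mult_scale_left mult_scale_right null3_rels)
    subgoal using \<mu> by (elim insertE emptyE)
      (simp_all add: distrib_left distrib_right mult_scale_left mult_scale_right null3_rels)
    subgoal using \<mu> by (elim insertE emptyE)
      (simp_all add: distrib_left distrib_right mult_scale_left mult_scale_right null3_rels)
    subgoal using \<mu> by (elim insertE emptyE)
      (simp_all add: distrib_left distrib_right mult_scale_left mult_scale_right null3_rels)
    done
  have sum_in: "free_ext free_scale \<gamma> q \<in> null3" if "\<And>x. \<gamma> x \<in> null3"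
    for \<gamma> :: "'a \<times> 'a \<Rightarrow> 'a \<times> 'a \<times> 'a \<Rightarrow>\<^sub>0 'k" and q
    unfolding free_ext_def
    by (intro free.subspace_sum[OF subspace_null3] free.subspace_scale[OF subspace_null3] that)
  have ext_add: "free_ext free_scale \<gamma> q - (free_ext free_scale \<gamma>' q + free_ext free_scale \<gamma>'' q) =
      free_ext free_scale (\<lambda>x. \<gamma> x - (\<gamma>' x + \<gamma>'' x)) q"
    for \<gamma> \<gamma>' \<gamma>'' :: "'a \<times> 'a \<Rightarrow> 'a \<times> 'a \<times> 'a \<Rightarrow>\<^sub>0 'k" and q
    by (simp add: free_ext_def free.scale_right_diff_distrib free.scale_right_distrib
        sum.distrib sum_subtractf)
  have ext_scale: "free_ext free_scale \<gamma> q - free_scale t (free_ext free_scale \<gamma>' q) =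
      free_ext free_scale (\<lambda>x. \<gamma> x - free_scale t (\<gamma>' x)) q"
    for \<gamma> \<gamma>' :: "'a \<times> 'a \<Rightarrow> 'a \<times> 'a \<times> 'a \<Rightarrow>\<^sub>0 'k" and q t
    by (simp add: free_ext_def free.scale_right_diff_distrib free.scale_sum_right
        free.scale_left_commute sum_subtractf mult.commute)
  have first: "F p' q - F p q \<in> null3" if "p' \<in> coset null2 p" for p p' q
    unfolding F_def
    by (rule free_ext_cong_null2[OF free.vector_space_axioms subspace_null3 _ _ _ _ that])
       (auto simp: ext_add ext_scale intro!: sum_in gen_rel)
  have diff: "F p q' - F p q =
      free_ext free_scale (\<lambda>x. ?G x q' - ?G x q) p" for p q q'
    by (simp add: F_def free_ext_def free.scale_right_diff_distrib sum_subtractf case_prod_beta)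
  have G: "?G x q' - ?G x q \<in> null3" if "q' \<in> coset null2 q" for x q q'
    by (rule free_ext_cong_null2[OF free.vector_space_axioms subspace_null3 _ _ _ _ that])
       (auto intro!: gen_rel)
  have second: "F p q' - F p q \<in> null3" if "q' \<in> coset null2 q" for p q q'
    unfolding diff by (intro sum_in G that)
  have "F p' q' - F p q \<in> null3" if "p' \<in> coset null2 p" "q' \<in> coset null2 q" for p' q'
    using free.subspace_add[OF subspace_null3 first[OF that(1), of q'] second[OF that(2), of p]]
    by simp
  then have "coset null3 (F p' q') = coset null3 (F p q)"
    if "p' \<in> coset null2 p" "q' \<in> coset null2 q" for p' q'
    using that by (simp add: free.coset_eq_iff[OF subspace_null3])
  then have "(\<Union>p'\<in>coset null2 p. \<Union>q'\<in>coset null2 q. coset null3 (F p' q')) =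
      coset null3 (F p q)"
    using self_in_coset_null2[of p] self_in_coset_null2[of q] by blast
  then show ?thesis
    by (simp add: yb_prod_def F_def)
qed

end

end

theory Submission
  imports Defs
begin

text \<open>The idea is to evaluate the last two factors of an element of \<open>A \<otimes> A \<otimes> A\<close> at linear
  functionals \<open>v\<close> and \<open>u\<close>; write \<open>\<langle>v, u\<rangle>\<close> for the resulting map
  \<open>x \<otimes> y \<otimes> z \<mapsto> v(y) u(z) x\<close> into \<open>A\<close>. Let \<open>r = \<Sum> a \<otimes> b\<close> and \<open>s = \<Sum> c \<otimes> d\<close> be tensors,
  with \<open>s\<close> skew-symmetric. Then

  \<^item> \<open>r\<^sup>\<sharp>(u) s\<^sup>\<sharp>(v) = \<langle>v, u\<rangle> (\<Sum> a c \<otimes> d \<otimes> b)\<close>;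
  \<^item> \<open>r\<^sup>\<sharp>(s\<^sup>\<sharp>(u) \<cdot> v) = \<langle>v, u\<rangle> (\<Sum> a \<otimes> b c \<otimes> d)\<close>;
  \<^item> \<open>r\<^sup>\<sharp>(u \<cdot> s\<^sup>\<sharp>(v)) = - \<langle>v, u\<rangle> (\<Sum> a \<otimes> c \<otimes> d b)\<close>, where skew-symmetry lets \<open>s\<^sup>\<sharp>(v)\<close> be
    written as \<open>- \<Sum> v(c) d\<close>.

  So the failure of the \<open>\<O>\<close>-operator identity for \<open>(r, s)\<close> at \<open>(u, v)\<close> is \<open>\<langle>v, u\<rangle>\<close> applied to the
  Yang-Baxter expression of \<open>(r, s)\<close> (lemma \<open>O_operator_defect\<close>). With \<open>r = s\<close> this compares the
  individual equations, and the sum over both orders of \<open>r\<^sub>1\<close> and \<open>r\<^sub>2\<close> compares the compatibility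
  conditions.

  The equivalence then rests on the fact that an element of \<open>A \<otimes> A \<otimes> A\<close> on which all \<open>\<langle>v, u\<rangle>\<close>
  vanish is zero (lemma \<open>null3_if_contract_zero\<close>). The coordinate functionals of a basis of \<open>A\<close>
  suffice for this, even in infinite dimension, since only finitely many basis vectors occur in a
  given tensor.\<close>

section \<open>Linear extension to formal sums\<close>

lemma linear_free_ext_commute:
  assumes "Vector_Spaces.linear s s' L"
  shows "L (free_ext s \<beta> p) = free_ext s' (\<lambda>x. L (\<beta> x)) p"
proof -
  interpret Vector_Spaces.linear s s' L by fact
  show ?thesis by (simp add: free_ext_def sum scale)
qed

lemma free_ext_swap:
  assumes "vector_space s"
  shows "free_ext s (\<lambda>x. free_ext s (\<gamma> x) q) p = free_ext s (\<lambda>y. free_ext s (\<lambda>x. \<gamma> x y) p) q"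
proof -
  interpret vector_space s by fact
  show ?thesis
    unfolding free_ext_def scale_sum_right
    by (subst sum.swap) (simp add: mult.commute)
qed

lemma free_ext_gen_self: "free_ext free_scale gen p = p"
proof (rule poly_mapping_eqI)
  fix x
  have "Poly_Mapping.lookup (free_ext free_scale gen p) x =
      (\<Sum>y\<in>Poly_Mapping.keys p. if y = x then Poly_Mapping.lookup p y else 0)"
    unfolding free_ext_def lookup_sum
    by (intro sum.cong) (auto simp: gen_def lookup_single)
  also have "\<dots> = Poly_Mapping.lookup p x"
    by (simp add: in_keys_iff)
  finally show "Poly_Mapping.lookup (free_ext free_scale gen p) x = Poly_Mapping.lookup p x" .
qed

section \<open>Contracting triple tensors with functionals\<close>

context assoc_algebra
begin

lemma linear_dual: "f \<in> dual_space scale \<Longrightarrow> Vector_Spaces.linear scale (*) f"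
  by (simp add: dual_space_def)

lemma linear_mult_left: "Vector_Spaces.linear scale scale ((*) w)"
  by (simp add: linear_iff_module_hom module_hom_iff module_axioms distrib_left mult_scale_right)

lemma linear_mult_right: "Vector_Spaces.linear scale scale (\<lambda>x. x * w)"
  by (simp add: linear_iff_module_hom module_hom_iff module_axioms distrib_right mult_scale_left)

lemma linear_scale_vector: "Vector_Spaces.linear (*) scale (\<lambda>c. scale c a)"
proof -
  interpret F: vector_space "(*) :: 'k \<Rightarrow> 'k \<Rightarrow> 'k" by (rule vector_space_field)
  show ?thesis
    by (simp add: linear_iff_module_hom module_hom_iff module_axioms F.module_axioms
        scale_left_distrib)
qed

text \<open>This is \<open>id \<otimes> v \<otimes> u\<close>. The functionals appear in this order because, in
  \<open>\<Sum> a c \<otimes> d \<otimes> b\<close>, it is the last factor that comes from the tensor paired with \<open>u\<close>.\<close>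

definition contract :: "('a \<Rightarrow> 'k) \<Rightarrow> ('a \<Rightarrow> 'k) \<Rightarrow> (('a \<times> 'a \<times> 'a) \<Rightarrow>\<^sub>0 'k) \<Rightarrow> 'a" where
  "contract v u = free_ext scale (\<lambda>(x, y, z). scale (v y * u z) x)"

lemma linear_contract: "Vector_Spaces.linear free_scale scale (contract v u)"
  unfolding contract_def by (rule linear_free_ext[OF vector_space_axioms])

lemma contract_gen [simp]: "contract v u (gen (x, y, z)) = scale (v y * u z) x"
  unfolding contract_def by (simp add: free_ext_gen[OF vector_space_axioms])

text \<open>The contraction is multilinear on generators, so it descends to \<open>A \<otimes> A \<otimes> A\<close>.\<close>

lemma contract_null3:
  assumes "t \<in> null3" "v \<in> dual_space scale" "u \<in> dual_space scale"
  shows "contract v u t = 0"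
proof -
  interpret C: Vector_Spaces.linear free_scale scale "contract v u" by (rule linear_contract)
  have "null3 \<subseteq> {t. contract v u t = 0}"
    unfolding null3_def
  proof (rule free.span_minimal)
    show "free.subspace {t. contract v u t = 0}" by (rule C.subspace_kernel)
  qed (use assms(2,3) in \<open>auto simp: C.diff C.add C.scale dual_space_iff scale_left_distrib
          scale_right_distrib distrib_left distrib_right mult.commute mult.left_commute\<close>)
  with assms(1) show ?thesis by blast
qed

lemma linear_mod_subspace_sum:
  fixes \<phi> :: "'a \<Rightarrow> ('x \<Rightarrow>\<^sub>0 'k)"
  assumes N: "free.subspace N"
    and add: "\<And>x y. \<phi> (x + y) - (\<phi> x + \<phi> y) \<in> N"
    and scl: "\<And>c x. \<phi> (scale c x) - free_scale c (\<phi> x) \<in> N"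
    and "finite S"
  shows "\<phi> (\<Sum>i\<in>S. scale (c i) (x i)) - (\<Sum>i\<in>S. free_scale (c i) (\<phi> (x i))) \<in> N"
  using \<open>finite S\<close>
proof induction
  case empty
  show ?case using scl[of 0 0] by simp
next
  case (insert i S)
  let ?y = "\<Sum>i\<in>S. scale (c i) (x i)" and ?s = "\<Sum>i\<in>S. free_scale (c i) (\<phi> (x i))"
  have "(\<phi> (scale (c i) (x i) + ?y) - (\<phi> (scale (c i) (x i)) + \<phi> ?y)) +
      ((\<phi> (scale (c i) (x i)) - free_scale (c i) (\<phi> (x i))) + (\<phi> ?y - ?s)) \<in> N"
    by (intro free.subspace_add[OF N] add scl insert.IH)
  then show ?case using insert.hyps by (simp add: algebra_simps)
qed

text \<open>Expanding the second and third factors in a basis \<open>B\<close> turns a formal sum \<open>t\<close> into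
  \<open>\<Sum> i j. x i j \<otimes> i \<otimes> j\<close> modulo the multilinearity relations, with \<open>i, j\<close> in \<open>B\<close>. Here \<open>x i j\<close>
  is the contraction of \<open>t\<close> with the coordinate functionals of \<open>i\<close> and \<open>j\<close>, which is zero by
  hypothesis.\<close>

lemma null3_if_contract_zero:
  assumes zero: "\<And>v u. v \<in> dual_space scale \<Longrightarrow> u \<in> dual_space scale \<Longrightarrow> contract v u t = 0"
  shows "t \<in> null3"
proof -
  obtain B where indep: "independent B" and "UNIV \<subseteq> span B"
    using basis_exists[of UNIV] by blast
  then have span: "y \<in> span B" for y by blast
  define coord where "coord i y = representation B y i" for i y
  have coord: "coord i \<in> dual_space scale" for i
    by (simp add: dual_space_iff coord_def representation_add[OF indep span span]
        representation_scale[OF indep span])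
  define K where "K = Poly_Mapping.keys t"
  \<comment> \<open>the finitely many basis vectors that occur in the last two factors of \<open>t\<close>\<close>
  define S where "S = (\<Union>(x, y, z)\<in>K. {i. coord i y \<noteq> 0} \<union> {i. coord i z \<noteq> 0})"
  have "finite S"
    unfolding S_def K_def coord_def by (auto simp: finite_representation)
  have expand: "(\<Sum>i\<in>S. scale (coord i y) i) = y" if "{i. coord i y \<noteq> 0} \<subseteq> S" for y
  proof -
    have "(\<Sum>i\<in>S. scale (coord i y) i) = (\<Sum>i | representation B y i \<noteq> 0. scale (representation B y i) i)"
      using that \<open>finite S\<close> unfolding coord_def by (intro sum.mono_neutral_right) auto
    also have "\<dots> = y" by (rule sum_nonzero_representation_eq[OF indep span])
    finally show ?thesis .
  qed
  note N = subspace_null3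
  \<comment> \<open>the \<open>(i, j)\<close> term of the basis expansion of a generator\<close>
  define E where "E k i j = (case k of (x, y, z) \<Rightarrow> free_scale (coord i y * coord j z) (gen (x, i, j)))"
    for k :: "'a \<times> 'a \<times> 'a" and i j
  have gen_expand: "gen k - (\<Sum>i\<in>S. \<Sum>j\<in>S. E k i j) \<in> null3" if "k \<in> K" for k
  proof -
    obtain x y z where k: "k = (x, y, z)" by (cases k)
    have "{i. coord i y \<noteq> 0} \<subseteq> S" "{i. coord i z \<noteq> 0} \<subseteq> S"
      using that unfolding k S_def by blast+
    then have y: "(\<Sum>i\<in>S. scale (coord i y) i) = y" and z: "(\<Sum>j\<in>S. scale (coord j z) j) = z"
      by (simp_all add: expand)
    have "gen (x, y, z) - (\<Sum>i\<in>S. free_scale (coord i y) (gen (x, i, z))) \<in> null3"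
      using linear_mod_subspace_sum[OF N, of "\<lambda>y. gen (x, y, z)" S "\<lambda>i. coord i y" "\<lambda>i. i",
          OF null3_rels(2) null3_rels(5) \<open>finite S\<close>] unfolding y .
    moreover have "(\<Sum>i\<in>S. free_scale (coord i y)
        (gen (x, i, z) - (\<Sum>j\<in>S. free_scale (coord j z) (gen (x, i, j))))) \<in> null3"
    proof (intro free.subspace_sum[OF N] free.subspace_scale[OF N])
      fix i
      show "gen (x, i, z) - (\<Sum>j\<in>S. free_scale (coord j z) (gen (x, i, j))) \<in> null3"
        using linear_mod_subspace_sum[OF N, of "\<lambda>z. gen (x, i, z)" S "\<lambda>j. coord j z" "\<lambda>j. j",
            OF null3_rels(3) null3_rels(6) \<open>finite S\<close>] unfolding z .
    qed
    ultimately show ?thesis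
      using free.subspace_add[OF N] unfolding k E_def
      by (fastforce simp: free.scale_right_diff_distrib free.scale_sum_right sum_subtractf)
  qed
  \<comment> \<open>the \<open>(i, j)\<close> terms of all generators of \<open>t\<close> together amount to \<open>x i j \<otimes> i \<otimes> j\<close>, where
    \<open>x i j = 0\<close>\<close>
  have E_sum: "(\<Sum>k\<in>K. free_scale (Poly_Mapping.lookup t k) (E k i j)) \<in> null3" for i j
  proof -
    define c where "c k = (case k of (x, y, z) \<Rightarrow> Poly_Mapping.lookup t k * (coord i y * coord j z))" for k
    have "(\<Sum>k\<in>K. scale (c k) (fst k)) = contract (coord i) (coord j) t"
      unfolding contract_def free_ext_def K_def c_def by (intro sum.cong) auto
    also have "\<dots> = 0" by (intro zero coord)
    finally have "gen (0, i, j) - (\<Sum>k\<in>K. free_scale (c k) (gen (fst k, i, j))) \<in> null3"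
      using linear_mod_subspace_sum[OF N, of "\<lambda>x. gen (x, i, j)" K c fst]
        null3_rels by (simp add: K_def)
    moreover have "gen (0, i, j) \<in> null3"
      using null3_rels(4)[of 0 0 i j] by simp
    ultimately have "(\<Sum>k\<in>K. free_scale (c k) (gen (fst k, i, j))) \<in> null3"
      using free.subspace_diff[OF N, of "gen (0, i, j)"
          "gen (0, i, j) - (\<Sum>k\<in>K. free_scale (c k) (gen (fst k, i, j)))"] by simp
    moreover have "(\<Sum>k\<in>K. free_scale (Poly_Mapping.lookup t k) (E k i j)) =
        (\<Sum>k\<in>K. free_scale (c k) (gen (fst k, i, j)))"
      by (intro sum.cong) (auto simp: E_def c_def)
    ultimately show ?thesis by simp
  qed
  have "(\<Sum>i\<in>S. \<Sum>j\<in>S. \<Sum>k\<in>K. free_scale (Poly_Mapping.lookup t k) (E k i j)) \<in> null3"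
    by (rule free.subspace_sum[OF N], rule free.subspace_sum[OF N], rule E_sum)
  moreover have "(\<Sum>k\<in>K. free_scale (Poly_Mapping.lookup t k)
      (gen k - (\<Sum>i\<in>S. \<Sum>j\<in>S. E k i j))) \<in> null3"
    by (rule free.subspace_sum[OF N], rule free.subspace_scale[OF N], rule gen_expand)
  ultimately have "(\<Sum>k\<in>K. free_scale (Poly_Mapping.lookup t k) (gen k - (\<Sum>i\<in>S. \<Sum>j\<in>S. E k i j))) +
      (\<Sum>i\<in>S. \<Sum>j\<in>S. \<Sum>k\<in>K. free_scale (Poly_Mapping.lookup t k) (E k i j)) \<in> null3"
    by (rule free.subspace_add[OF N, rotated])
  moreover have "(\<Sum>i\<in>S. \<Sum>j\<in>S. \<Sum>k\<in>K. free_scale (Poly_Mapping.lookup t k) (E k i j)) =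
      (\<Sum>k\<in>K. free_scale (Poly_Mapping.lookup t k) (\<Sum>i\<in>S. \<Sum>j\<in>S. E k i j))"
    by (simp add: free.scale_sum_right sum.swap[of _ K])
  moreover have "(\<Sum>k\<in>K. free_scale (Poly_Mapping.lookup t k) (gen k)) = t"
    using free_ext_gen_self[of t] by (simp add: free_ext_def K_def)
  ultimately show ?thesis
    by (simp add: free.scale_right_diff_distrib sum_subtractf)
qed

lemma null3_iff_contract:
  "t \<in> null3 \<longleftrightarrow> (\<forall>u\<in>dual_space scale. \<forall>v\<in>dual_space scale. contract v u t = 0)"
  using contract_null3 null3_if_contract_zero by blast

section \<open>The terms of the O-operator identity as contractions\<close>

text \<open>The representative that \<^const>\<open>yb_prod\<close> attaches to formal sums \<open>p\<close> and \<open>q\<close>. The identities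
  below are computed on representatives, where they are identities of finite sums.\<close>

definition yb_sum :: "('a \<Rightarrow> 'a \<Rightarrow> 'a \<Rightarrow> 'a \<Rightarrow> 'a \<times> 'a \<times> 'a) \<Rightarrow>
    (('a \<times> 'a) \<Rightarrow>\<^sub>0 'k) \<Rightarrow> (('a \<times> 'a) \<Rightarrow>\<^sub>0 'k) \<Rightarrow> (('a \<times> 'a \<times> 'a) \<Rightarrow>\<^sub>0 'k)" where
  "yb_sum \<mu> p q =
     free_ext free_scale (\<lambda>(a, b). free_ext free_scale (\<lambda>(c, d). gen (\<mu> a b c d)) q) p"

lemma contract_yb_sum:
  "contract v u (yb_sum \<mu> p q) =
     free_ext scale (\<lambda>(a, b). free_ext scale (\<lambda>(c, d). contract v u (gen (\<mu> a b c d))) q) p"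
  unfolding yb_sum_def split_def linear_free_ext_commute[OF linear_contract] ..

definition left_sum where "left_sum = yb_sum (\<lambda>a b c d. (a * c, d, b))"
definition middle_sum where "middle_sum = yb_sum (\<lambda>a b c d. (a, b * c, d))"
definition right_sum where "right_sum = yb_sum (\<lambda>a b c d. (c, a, b * d))"

lemma yb_coset:
  "yb_left (coset null2 p) (coset null2 q) = coset null3 (left_sum p q)"
  "yb_middle (coset null2 p) (coset null2 q) = coset null3 (middle_sum p q)"
  "yb_right (coset null2 p) (coset null2 q) = coset null3 (right_sum p q)"
  unfolding yb_left_def yb_middle_def yb_right_def left_sum_def middle_sum_def right_sum_def
    yb_sum_def
  by (simp_all add: yb_prod_coset)

lemma mult_sharp:
  assumes "u \<in> dual_space scale" "v \<in> dual_space scale"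
  shows "sharp (coset null2 p) u * sharp (coset null2 q) v = contract v u (left_sum p q)"
proof -
  have "sharp (coset null2 p) u * sharp (coset null2 q) v =
      free_ext scale (\<lambda>x. free_ext scale (\<lambda>y.
        scale (u (snd x)) (fst x) * scale (v (snd y)) (fst y)) q) p"
    unfolding sharp_coset[OF assms(1)] sharp_coset[OF assms(2)] split_def
      linear_free_ext_commute[OF linear_mult_right] linear_free_ext_commute[OF linear_mult_left]
    by (subst free_ext_swap[OF vector_space_axioms]) rule
  then show ?thesis
    by (simp add: left_sum_def contract_yb_sum split_def mult_scale_left mult_scale_right mult.commute)
qed

lemma sharp_coad_left:
  assumes "u \<in> dual_space scale" "v \<in> dual_space scale"
  shows "sharp (coset null2 p) (coad_left (sharp (coset null2 q) u) v) =
    contract v u (middle_sum p q)"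
proof -
  have v: "v (scale c a) = c * v a" for c a using assms(2) by (simp add: dual_space_iff)
  have "sharp (coset null2 p) (coad_left (sharp (coset null2 q) u) v) =
      free_ext scale (\<lambda>x. scale (v (snd x * sharp (coset null2 q) u)) (fst x)) p"
    unfolding sharp_coset[OF coadjoint.lact_closed[OF assms(2)]]
    by (simp add: split_def coad_left_def)
  also have "\<dots> = free_ext scale (\<lambda>x. free_ext scale (\<lambda>y.
      scale (v (snd x * scale (u (snd y)) (fst y))) (fst x)) q) p"
    unfolding sharp_coset[OF assms(1)] split_def linear_free_ext_commute[OF linear_mult_left]
      linear_free_ext_commute[OF linear_dual[OF assms(2)]]
      linear_free_ext_commute[OF linear_scale_vector] ..
  finally show ?thesis
    by (simp add: middle_sum_def contract_yb_sum split_def mult_scale_right v mult.commute)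
qed

text \<open>Skew-symmetry allows the functional to be evaluated on the first factor instead, at the cost
  of a sign. This sign is what makes the third term of the Yang-Baxter equation appear with a
  plus.\<close>

lemma sharp_skew_symmetric:
  assumes "skew_symmetric (coset null2 q)" "v \<in> dual_space scale"
  shows "sharp (coset null2 q) v = - free_ext scale (\<lambda>(c, d). scale (v c) d) q"
proof -
  let ?S = "free_ext scale (\<lambda>(c, d). scale (v d) c)"
  let ?q' = "free_ext free_scale (\<lambda>(c, d). gen (d, c)) q"
  have lin: "Vector_Spaces.linear free_scale scale ?S"
    by (rule linear_free_ext[OF vector_space_axioms])
  interpret S: Vector_Spaces.linear free_scale scale ?S by (rule lin)
  have "coset null2 ?q' = coset null2 (- q)"
    using assms(1) by (simp add: skew_symmetric_def flip_coset free.coset_neg_coset[OF subspace_null2])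
  then have "?S ?q' = ?S (- q)"
    using sharp_coset[OF assms(2)] by metis
  moreover have "?S ?q' = free_ext scale (\<lambda>(c, d). scale (v c) d) q"
    unfolding linear_free_ext_commute[OF lin]
    by (simp add: split_def free_ext_gen[OF vector_space_axioms])
  ultimately show ?thesis
    by (simp add: sharp_coset[OF assms(2)] S.neg)
qed

text \<open>The left side is \<open>\<Sum> u(s\<^sup>\<sharp>(v) b) a\<close> for \<open>s = \<Sum> c \<otimes> d\<close>. In the Yang-Baxter terms a
  product in the last factor has the form \<open>d b\<close>, so \<open>s\<^sup>\<sharp>(v)\<close> has to be expanded along the second
  factor \<open>d\<close>; the roles of the two tensors are exchanged because \<open>d\<close> stands to the left of \<open>b\<close>.\<close>

lemma sharp_coad_right:
  assumes "skew_symmetric (coset null2 q)" "u \<in> dual_space scale" "v \<in> dual_space scale"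
  shows "sharp (coset null2 p) (coad_right u (sharp (coset null2 q) v)) =
    - contract v u (right_sum q p)"
proof -
  interpret U: Vector_Spaces.linear scale "(*)" u by (rule linear_dual[OF assms(2)])
  have "sharp (coset null2 p) (coad_right u (sharp (coset null2 q) v)) =
      free_ext scale (\<lambda>x. scale (u (sharp (coset null2 q) v * snd x)) (fst x)) p"
    unfolding sharp_coset[OF coadjoint.ract_closed[OF assms(2)]]
    by (simp add: split_def coad_right_def)
  also have "\<dots> = - free_ext scale (\<lambda>x. scale (u
      (free_ext scale (\<lambda>y. scale (v (fst y)) (snd y)) q * snd x)) (fst x)) p"
    unfolding sharp_skew_symmetric[OF assms(1,3)] split_def
    by (simp add: U.neg free_ext_def sum_negf)
  also have "\<dots> = - free_ext scale (\<lambda>x. free_ext scale (\<lambda>y.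
      scale (u (scale (v (fst y)) (snd y) * snd x)) (fst x)) q) p"
    unfolding linear_free_ext_commute[OF linear_mult_right]
      linear_free_ext_commute[OF linear_dual[OF assms(2)]]
      linear_free_ext_commute[OF linear_scale_vector] ..
  also have "\<dots> = - free_ext scale (\<lambda>y. free_ext scale (\<lambda>x.
      scale (u (scale (v (fst y)) (snd y) * snd x)) (fst x)) p) q"
    by (subst free_ext_swap[OF vector_space_axioms]) rule
  finally show ?thesis
    by (simp add: right_sum_def contract_yb_sum split_def mult_scale_left U.scale)
qed

lemma sharp_add:
  assumes "r \<in> tensor2" "f \<in> dual_space scale" "g \<in> dual_space scale"
  shows "sharp r (f + g) = sharp r f + sharp r g"
proof -
  obtain p where "r = coset null2 p" using assms(1) by (auto simp: tensor2_def)
  then show ?thesis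
    using coadjoint.M.subspace_add[OF coadjoint.subspace_M assms(2,3)] assms(2,3)
    by (simp add: sharp_coset free_ext_def split_def scale_left_distrib scale_right_distrib sum.distrib)
qed

lemma sharp_scale:
  assumes "r \<in> tensor2" "f \<in> dual_space scale"
  shows "sharp r (dual_scale c f) = scale c (sharp r f)"
proof -
  obtain p where "r = coset null2 p" using assms(1) by (auto simp: tensor2_def)
  then show ?thesis
    using coadjoint.M.subspace_scale[OF coadjoint.subspace_M assms(2)] assms(2)
    by (simp add: sharp_coset free_ext_def split_def dual_scale_def scale_sum_right mult.left_commute)
qed

section \<open>Yang-Baxter solutions and O-operators\<close>

text \<open>The last term has its arguments exchanged, as dictated by \<open>sharp_coad_right\<close>. For \<open>p = q\<close> and
  in the sum over both orders of \<open>p\<close> and \<open>q\<close> the exchange is invisible, and these are the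
  combinations in the Yang-Baxter equations.\<close>

definition yb_defect where
  "yb_defect p q = left_sum p q - middle_sum p q + right_sum q p"

lemma O_operator_defect:
  assumes "skew_symmetric (coset null2 q)" "u \<in> dual_space scale" "v \<in> dual_space scale"
  shows "sharp (coset null2 p) u * sharp (coset null2 q) v -
      sharp (coset null2 p)
        (coad_left (sharp (coset null2 q) u) v + coad_right u (sharp (coset null2 q) v)) =
    contract v u (yb_defect p q)"
proof -
  interpret C: Vector_Spaces.linear free_scale scale "contract v u" by (rule linear_contract)
  have "coset null2 p \<in> tensor2" by (simp add: tensor2_def)
  then show ?thesis
    using assms
    by (simp add: sharp_add coadjoint.lact_closed coadjoint.ract_closed mult_sharp sharp_coad_left
        sharp_coad_right yb_defect_def C.add C.diff)
qed

lemma AYB_solution_iff_O_operator: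
  assumes "r \<in> tensor2" "skew_symmetric r"
  shows "AYB_solution r \<longleftrightarrow> coadjoint.O_operator (sharp r)"
proof -
  obtain p where r: "r = coset null2 p" using assms(1) by (auto simp: tensor2_def)
  have "AYB_solution r \<longleftrightarrow> coset null3 (yb_defect p p) = coset null3 0"
    using assms(1)
    by (simp add: AYB_solution_def r yb_coset yb_defect_def free.coset_0
        free.coset_diff_coset[OF subspace_null3] free.coset_add_coset[OF subspace_null3])
  also have "\<dots> \<longleftrightarrow> yb_defect p p \<in> null3"
    by (simp add: free.coset_eq_iff[OF subspace_null3])
  also have "\<dots> \<longleftrightarrow> coadjoint.O_operator (sharp r)"
    using assms unfolding r
    by (simp add: null3_iff_contract coadjoint.O_operator_def sharp_add sharp_scale
        flip: O_operator_defect)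
  finally show ?thesis .
qed

lemma compatible_AYB_solution_iff_compatible_O_operator:
  assumes "r1 \<in> tensor2" "r2 \<in> tensor2" "skew_symmetric r1" "skew_symmetric r2"
  shows "compatible_AYB_solution r1 r2 \<longleftrightarrow>
    coadjoint.compatible_O_operator (sharp r1) (sharp r2)"
proof -
  obtain p1 p2 where r: "r1 = coset null2 p1" "r2 = coset null2 p2"
    using assms(1,2) by (auto simp: tensor2_def)
  have defect: "sharp r1 u * sharp r2 v + sharp r2 u * sharp r1 v =
        sharp r1 (coad_left (sharp r2 u) v + coad_right u (sharp r2 v)) +
        sharp r2 (coad_left (sharp r1 u) v + coad_right u (sharp r1 v)) \<longleftrightarrow>
      contract v u (yb_defect p1 p2 + yb_defect p2 p1) = 0"
    if "u \<in> dual_space scale" "v \<in> dual_space scale" for u v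
  proof -
    interpret C: Vector_Spaces.linear free_scale scale "contract v u" by (rule linear_contract)
    have "a + b = c + d \<longleftrightarrow> (a - c) + (b - d) = 0" for a b c d :: 'a
      by (simp add: algebra_simps eq_neg_iff_add_eq_0)
    with assms that show ?thesis
      unfolding r by (simp add: C.add flip: O_operator_defect)
  qed
  have "yb_left r1 r2 \<boxplus> yb_left r2 r1 \<boxminus> yb_middle r1 r2 \<boxminus> yb_middle r2 r1
      \<boxplus> yb_right r1 r2 \<boxplus> yb_right r2 r1 =
      coset null3 (yb_defect p1 p2 + yb_defect p2 p1)"
    by (simp add: r yb_coset yb_defect_def algebra_simps
        free.coset_diff_coset[OF subspace_null3] free.coset_add_coset[OF subspace_null3])
  moreover have "coset null3 t = null3 \<longleftrightarrow> t \<in> null3" for t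
    using free.coset_eq_iff[OF subspace_null3, of t 0] by (simp add: free.coset_0)
  ultimately show ?thesis
    using AYB_solution_iff_O_operator assms
    by (simp add: compatible_AYB_solution_def coadjoint.compatible_O_operator_def
        null3_iff_contract defect)
qed

end

theorem proposition2p10:
  fixes scale :: "'k::field_char_0 \<Rightarrow> 'a::ring \<Rightarrow> 'a"
    and r1 r2 :: "(('a \<times> 'a) \<Rightarrow>\<^sub>0 'k) set"
  assumes "assoc_algebra scale"
    and "r1 \<in> assoc_algebra.tensor2 scale" and "r2 \<in> assoc_algebra.tensor2 scale"
    and "assoc_algebra.skew_symmetric scale r1" and "assoc_algebra.skew_symmetric scale r2"
  shows "assoc_algebra.compatible_AYB_solution scale r1 r2 \<longleftrightarrow>
    bimodule.compatible_O_operator scale dual_scale (dual_space scale) coad_left coad_right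
      (assoc_algebra.sharp scale r1) (assoc_algebra.sharp scale r2)"
  using assms by (rule assoc_algebra.compatible_AYB_solution_iff_compatible_O_operator)

end
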